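(* Every inner product on the Lie algebra $A_{3,1}\oplus 2A_1$ is a Schouten like metric.
   Context: $\mathfrak{g}=A_{3,1}\oplus 2A_1$ is the five-dimensional real nilpotent Lie algebra having a basis $\{v_1,\dots,v_5\}$ whose only nonzero bracket (up to antisymmetry) is $[v_1,v_2]=\alpha v_5$ with $\alpha>0$ (all choices of $\alpha>0$ give isomorphic Lie algebras). An inner product on $\mathfrak{g}$ is identified with the left-invariant Riemannian metric $g$ it induces on the simply connected Lie group $G$ with Lie algebra $\mathfrak{g}$. Let $ric_g$ be the Ricci curvature tensor of $(G,g)$ (Levi-Civita connection), viewed as a symmetric bilinear form on $\mathfrak{g}$; since $\mathfrak{g}$ is nilpotent, $ric_g(u,v)=-\frac12\mathrm{tr}(ad_u\circ ad_v^* )-\frac14\mathrm{tr}(J_u\circ J_v)$, where $ad_uv=[u,v]$, $ad_v^*$ is the $g$-transpose of $ad_v$, and $J_uv=ad_v^*u$. The Ricci operator $Ric_g$ is defined by $ric_g(u,v)=g(Ric_g(u),v)$ and $s=\mathrm{tr}(Ric_g)$ is the scalar curvature. A derivation $D$ of $\mathfrak{g}$ is symmetric with respect to $g$ if $g(Du,v)=g(u,Dv)$ for all $u,v$. The metric $g$ is a Schouten like metric if there are real numbers $\lambda_0,c$ and a derivation $D$ of $\mathfrak{g}$, symmetric with respect to $g$, such that $ric_g(X,Y)=(s\lambda_0+c)g(X,Y)+g(D(X),Y)$ for all $X,Y\in\mathfrak{g}$. *)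

theory Defs
  imports "HOL-Analysis.Analysis"
begin

definition lie_bracket :: "('a::real_vector \<Rightarrow> 'a \<Rightarrow> 'a) \<Rightarrow> bool" where
  "lie_bracket br \<longleftrightarrow> bilinear br \<and> (\<forall>x. br x x = 0) \<and>
     (\<forall>x y z. br x (br y z) + br y (br z x) + br z (br x y) = 0)"

definition inner_product_on :: "('a::real_vector \<Rightarrow> 'a \<Rightarrow> real) \<Rightarrow> bool" where
  "inner_product_on g \<longleftrightarrow> bilinear g \<and> (\<forall>x y. g x y = g y x) \<and> (\<forall>x. x \<noteq> 0 \<longrightarrow> g x x > 0)"

definition derivation :: "('a::real_vector \<Rightarrow> 'a \<Rightarrow> 'a) \<Rightarrow> ('a \<Rightarrow> 'a) \<Rightarrow> bool" where
  "derivation br D \<longleftrightarrow> linear D \<and> (\<forall>x y. D (br x y) = br (D x) y + br x (D y))"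

definition symmetric_wrt :: "('a \<Rightarrow> 'a \<Rightarrow> real) \<Rightarrow> ('a \<Rightarrow> 'a) \<Rightarrow> bool" where
  "symmetric_wrt g D \<longleftrightarrow> (\<forall>u v. g (D u) v = g u (D v))"

text \<open>
  Left-invariant vector fields on the simply connected Lie group are identified with elements
  of its Lie algebra. For a left-invariant metric \<open>g\<close> the functions \<open>g(v, w)\<close>, with \<open>v\<close> and \<open>w\<close>
  left-invariant, are constant, so metric compatibility
  \<open>u(g(v, w)) = g(\<nabla>\<^sub>u v, w) + g(v, \<nabla>\<^sub>u w)\<close> has left-hand side \<open>0\<close>.
\<close>

definition is_levi_civita ::
    "('a::real_vector \<Rightarrow> 'a \<Rightarrow> 'a) \<Rightarrow> ('a \<Rightarrow> 'a \<Rightarrow> real) \<Rightarrow> ('a \<Rightarrow> 'a \<Rightarrow> 'a) \<Rightarrow> bool" where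
  "is_levi_civita br g N \<longleftrightarrow> bilinear N \<and>
     (\<forall>u v. N u v - N v u = br u v) \<and>
     (\<forall>u v w. g (N u v) w + g v (N u w) = 0)"

definition levi_civita ::
    "('a::real_vector \<Rightarrow> 'a \<Rightarrow> 'a) \<Rightarrow> ('a \<Rightarrow> 'a \<Rightarrow> real) \<Rightarrow> 'a \<Rightarrow> 'a \<Rightarrow> 'a" where
  "levi_civita br g = (THE N. is_levi_civita br g N)"

definition riemann ::
    "('a::real_vector \<Rightarrow> 'a \<Rightarrow> 'a) \<Rightarrow> ('a \<Rightarrow> 'a \<Rightarrow> real) \<Rightarrow> 'a \<Rightarrow> 'a \<Rightarrow> 'a \<Rightarrow> 'a" where
  "riemann br g u v w = (let N = levi_civita br g in
     N u (N v w) - N v (N u w) - N (br u v) w)"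

text \<open>
  With these sign conventions the Ricci tensor of a round sphere is positive, and on a nilpotent
  Lie algebra \<open>ricci\<close> is \<open>- tr(ad\<^sub>u ad\<^sub>v\<^sup>*) / 2 - tr(J\<^sub>u J\<^sub>v) / 4\<close>, where \<open>J\<^sub>u v = ad\<^sub>v\<^sup>* u\<close>.
\<close>

definition ricci ::
    "(real^'n \<Rightarrow> real^'n \<Rightarrow> real^'n) \<Rightarrow> (real^'n \<Rightarrow> real^'n \<Rightarrow> real) \<Rightarrow> real^'n \<Rightarrow> real^'n \<Rightarrow> real" where
  "ricci br g u v = trace (matrix (\<lambda>w. riemann br g w u v))"

definition ricci_operator ::
    "(real^'n \<Rightarrow> real^'n \<Rightarrow> real^'n) \<Rightarrow> (real^'n \<Rightarrow> real^'n \<Rightarrow> real) \<Rightarrow> real^'n \<Rightarrow> real^'n" where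
  "ricci_operator br g = (THE R. \<forall>u v. ricci br g u v = g (R u) v)"

definition scalar_curvature ::
    "(real^'n \<Rightarrow> real^'n \<Rightarrow> real^'n) \<Rightarrow> (real^'n \<Rightarrow> real^'n \<Rightarrow> real) \<Rightarrow> real" where
  "scalar_curvature br g = trace (matrix (ricci_operator br g))"

definition schouten_like ::
    "(real^'n \<Rightarrow> real^'n \<Rightarrow> real^'n) \<Rightarrow> (real^'n \<Rightarrow> real^'n \<Rightarrow> real) \<Rightarrow> bool" where
  "schouten_like br g \<longleftrightarrow> (\<exists>l\<^sub>0 c D. derivation br D \<and> symmetric_wrt g D \<and>
     (\<forall>X Y. ricci br g X Y = (scalar_curvature br g * l\<^sub>0 + c) * g X Y + g (D X) Y))"

text \<open>
  A five-dimensional real Lie algebra is presented on \<open>real^5\<close> with an arbitrary Lie bracket;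
  the basis \<open>v\<close> adapted to the bracket need not be the standard one.
\<close>

definition A31_2A1 :: "(real^5 \<Rightarrow> real^5 \<Rightarrow> real^5) \<Rightarrow> bool" where
  "A31_2A1 br \<longleftrightarrow> lie_bracket br \<and>
     (\<exists>(v::nat \<Rightarrow> real^5) \<alpha>. inj_on v {1..5} \<and> independent (v ` {1..5}) \<and> span (v ` {1..5}) = UNIV \<and>
        \<alpha> > 0 \<and> br (v 1) (v 2) = \<alpha> *\<^sub>R v 5 \<and>
        (\<forall>i\<in>{1..5}. \<forall>j\<in>{1..5}. i < j \<and> (i, j) \<noteq> (1, 2) \<longrightarrow> br (v i) (v j) = 0))"


subsection \<open>The definite descriptions above are proper\<close>

lemma inner_product_eqI:
  assumes "inner_product_on g" "\<And>x. g a x = g b x"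
  shows "a = b"
proof (rule ccontr)
  assume "a \<noteq> b"
  then have "g (a - b) (a - b) > 0"
    using assms(1) by (simp add: inner_product_on_def)
  moreover have "g (a - b) (a - b) = g a (a - b) - g b (a - b)"
    using assms(1) by (intro bilinear_lsub) (simp add: inner_product_on_def)
  ultimately show False
    using assms(2)[of "a - b"] by simp
qed

lemma inner_product_riesz:
  fixes g :: "real^'n \<Rightarrow> real^'n \<Rightarrow> real"
  assumes g: "inner_product_on g" and f: "linear f"
  shows "\<exists>w. \<forall>x. g w x = f x"
proof -
  have bil: "bilinear g"
    using g by (simp add: inner_product_on_def)
  define T where "T = (\<lambda>w. (\<chi> i. g w (axis i 1)) :: real^'n)"
  have exp: "h x = (\<Sum>i\<in>UNIV. x $ i * h (axis i 1))" if "linear h" for h :: "real^'n \<Rightarrow> real" and x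
    by (subst basis_expansion[symmetric, of x])
       (simp add: linear_sum[OF that] linear_cmul[OF that] scalar_mult_eq_scaleR)
  have lin: "linear (g w)" for w
    using bil by (simp add: bilinear_def)
  have "linear T"
    by (rule linearI) (simp_all add: T_def vec_eq_iff bilinear_ladd[OF bil] bilinear_lmul[OF bil])
  moreover have "inj T"
  proof (rule injI)
    fix a b assume "T a = T b"
    then have "g a (axis i 1) = g b (axis i 1)" for i
      by (simp add: T_def vec_eq_iff)
    then have "g a x = g b x" for x
      by (subst (1 2) exp[OF lin]) simp
    then show "a = b"
      by (rule inner_product_eqI[OF g])
  qed
  ultimately have "surj T"
    by (rule linear_inj_imp_surj)
  then obtain w where "T w = (\<chi> i. f (axis i 1))"
    by (metis surjD)
  then have "g w (axis i 1) = f (axis i 1)" for i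
    by (simp add: T_def vec_eq_iff)
  then have "g w x = f x" for x
    by (subst exp[OF lin], subst exp[OF f]) simp
  then show ?thesis by blast
qed

lemma is_levi_civita_koszul:
  assumes g: "inner_product_on g" and N: "is_levi_civita br g N"
  shows "2 * g (N u v) w = g (br u v) w - g (br v w) u + g (br w u) v"
proof -
  have bil: "bilinear g" and sym: "\<And>x y. g x y = g y x"
    using g by (simp_all add: inner_product_on_def)
  have br: "br x y = N x y - N y x" for x y
    using N by (simp add: is_levi_civita_def)
  have met: "g (N x y) z + g (N x z) y = 0" for x y z
    using N sym by (metis is_levi_civita_def)
  show ?thesis
    using met[of u v w] met[of v u w] met[of w u v]
    by (simp add: br bilinear_lsub[OF bil])
qed

lemma levi_civita_exists:
  fixes g :: "real^'n \<Rightarrow> real^'n \<Rightarrow> real"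
  assumes g: "inner_product_on g" and br: "lie_bracket br"
  shows "\<exists>N. is_levi_civita br g N"
proof -
  have bil: "bilinear g" and sym: "\<And>x y. g x y = g y x"
    using g by (simp_all add: inner_product_on_def)
  have bb: "bilinear br" and alt: "\<And>x. br x x = 0"
    using br by (simp_all add: lie_bracket_def)
  have anti: "br x y = - br y x" for x y
    using alt[of "x + y"] alt[of x] alt[of y]
    by (simp add: bilinear_ladd[OF bb] bilinear_radd[OF bb] eq_neg_iff_add_eq_0 add.commute)
  have gneg: "g (- x) y = - g x y" for x y
    by (rule bilinear_lneg[OF bil])
  note ling = bilinear_ladd[OF bil] bilinear_radd[OF bil] bilinear_lmul[OF bil] bilinear_rmul[OF bil]
  note linb = bilinear_ladd[OF bb] bilinear_radd[OF bb] bilinear_lmul[OF bb] bilinear_rmul[OF bb]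
  define K where "K u v w = (g (br u v) w - g (br v w) u + g (br w u) v) / 2" for u v w
  have "\<exists>n. \<forall>w. g n w = K u v w" for u v
    by (rule inner_product_riesz[OF g], rule linearI)
       (simp_all add: K_def ling linb algebra_simps add_divide_distrib diff_divide_distrib)
  then obtain N where N: "g (N u v) w = K u v w" for u v w
    by metis
  have "N (x + y) v = N x v + N y v" "N v (x + y) = N v x + N v y"
    "N (c *\<^sub>R x) v = c *\<^sub>R N x v" "N v (c *\<^sub>R x) = c *\<^sub>R N v x" for x y v c
    by (rule inner_product_eqI[OF g],
        simp add: N ling K_def linb algebra_simps add_divide_distrib diff_divide_distrib)+
  then have "bilinear N"
    by (simp add: bilinear_def linear_iff)
  moreover have "N u v - N v u = br u v" for u v
  proof (rule inner_product_eqI[OF g])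
    fix x
    have "g (N u v - N v u) x = K u v x - K v u x"
      by (simp add: N bilinear_lsub[OF bil])
    also have "\<dots> = g (br u v) x"
      unfolding K_def anti[of v u] anti[of x v] anti[of x u] gneg by (simp add: field_simps)
    finally show "g (N u v - N v u) x = g (br u v) x" .
  qed
  moreover have "g (N u v) w + g v (N u w) = 0" for u v w
  proof -
    have "g (N u v) w + g v (N u w) = K u v w + K u w v"
      by (simp add: N sym[of v])
    also have "\<dots> = 0"
      unfolding K_def anti[of w u] anti[of w v] anti[of v u] gneg by (simp add: field_simps)
    finally show ?thesis .
  qed
  ultimately show ?thesis
    by (auto simp: is_levi_civita_def)
qed

lemma levi_civita_is_levi_civita:
  fixes g :: "real^'n \<Rightarrow> real^'n \<Rightarrow> real"
  assumes g: "inner_product_on g" and br: "lie_bracket br"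
  shows "is_levi_civita br g (levi_civita br g)"
proof -
  have "\<exists>!N. is_levi_civita br g N"
  proof (rule ex_ex1I[OF levi_civita_exists[OF assms]])
    fix N N' assume *: "is_levi_civita br g N" "is_levi_civita br g N'"
    have "N u v = N' u v" for u v
    proof (rule inner_product_eqI[OF g])
      fix x show "g (N u v) x = g (N' u v) x"
        using is_levi_civita_koszul[OF g *(1), of u v x] is_levi_civita_koszul[OF g *(2), of u v x]
        by simp
    qed
    then show "N = N'" by (intro ext)
  qed
  then show ?thesis
    unfolding levi_civita_def by (rule theI')
qed

lemma ricci_operator_ricci:
  fixes g :: "real^'n \<Rightarrow> real^'n \<Rightarrow> real"
  assumes g: "inner_product_on g" and br: "lie_bracket br"
  shows "ricci br g u v = g (ricci_operator br g u) v"
proof -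
  have NB: "bilinear (levi_civita br g)"
    using levi_civita_is_levi_civita[OF assms] by (simp add: is_levi_civita_def)
  have lin: "linear (ricci br g u)" for u
    by (rule linearI)
       (simp_all add: ricci_def trace_def matrix_def riemann_def Let_def
          bilinear_radd[OF NB] bilinear_rmul[OF NB] sum.distrib sum_subtractf sum_distrib_left
          algebra_simps)
  have "\<exists>!R. \<forall>u v. ricci br g u v = g (R u) v"
  proof (rule ex_ex1I)
    show "\<exists>R. \<forall>u v. ricci br g u v = g (R u) v"
      using inner_product_riesz[OF g lin] by metis
  next
    fix R R' assume "\<forall>u v. ricci br g u v = g (R u) v" "\<forall>u v. ricci br g u v = g (R' u) v"
    then show "R = R'"
      by (intro ext inner_product_eqI[OF g]) simp
  qed
  from theI'[OF this] show ?thesis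
    unfolding ricci_operator_def by blast
qed

end

theory Submission
  imports Defs
begin

text \<open>
  The bracket is a decomposable \<open>2\<close>-form times a vector. Gram--Schmidt on the Riesz representatives
  of the two functionals gives orthonormal \<open>e\<^sub>1, e\<^sub>2, e\<^sub>5\<close> with
  \<open>[x, y] = a (x\<^sub>1 y\<^sub>2 - x\<^sub>2 y\<^sub>1) e\<^sub>5\<close>, whatever the metric. The Ricci operator is then
  \<open>- a\<^sup>2 / 2\<close> on \<open>e\<^sub>1, e\<^sub>2\<close>, \<open>a\<^sup>2 / 2\<close> on \<open>e\<^sub>5\<close> and \<open>0\<close> on the orthogonal complement. A multiple of
  the identity is subtracted so that the eigenvalue at \<open>e\<^sub>5\<close> becomes the sum of those at \<open>e\<^sub>1\<close> and
  \<open>e\<^sub>2\<close>; this constant is \<open>- 3 a\<^sup>2 / 2\<close>, and \<open>\<lambda>\<^sub>0 = 0\<close> suffices.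
\<close>

text \<open>Taking traces of rank-one maps directly avoids completing \<open>e\<^sub>1\<close>,
  \<open>e\<^sub>2\<close>, \<open>e\<^sub>5\<close> to an orthonormal basis.\<close>

lemma trace_matrix_scaleR:
  fixes f :: "real^'n \<Rightarrow> real" and b :: "real^'n"
  assumes "linear f"
  shows "trace (matrix (\<lambda>w. f w *\<^sub>R b)) = f b"
proof -
  have "f b = f (\<Sum>i\<in>UNIV. b $ i *s axis i 1)"
    by (simp add: basis_expansion)
  also have "\<dots> = (\<Sum>i\<in>UNIV. b $ i * f (axis i 1))"
    by (simp add: linear_sum[OF assms] linear_cmul[OF assms] scalar_mult_eq_scaleR)
  finally show ?thesis
    by (simp add: trace_def matrix_def mult.commute)
qed

lemma trace_matrix_add:
  fixes f h :: "real^'n \<Rightarrow> real^'n"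
  shows "trace (matrix (\<lambda>w. f w + h w)) = trace (matrix f) + trace (matrix h)"
  by (simp add: trace_def matrix_def sum.distrib)

text \<open>The Koszul formula fixes \<open>g (N u v) w\<close> for every \<open>w\<close>, and
  \<open>g\<close> is nondegenerate.\<close>

lemma levi_civita_eqI:
  fixes g :: "real^'n \<Rightarrow> real^'n \<Rightarrow> real"
  assumes g: "inner_product_on g" and br: "lie_bracket br"
    and N: "\<And>u v w. 2 * g (N u v) w = g (br u v) w - g (br v w) u + g (br w u) v"
  shows "levi_civita br g = N"
proof (intro ext inner_product_eqI[OF g])
  fix u v x
  show "g (levi_civita br g u v) x = g (N u v) x"
    using is_levi_civita_koszul[OF g levi_civita_is_levi_civita[OF g br], of u v x] N[of u v x]
    by simp
qed

text \<open>Coordinates are encoded as \<open>g e\<^sub>1 x\<close> and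
  \<open>g e\<^sub>2 x\<close>, so the orthogonal complement of the three vectors never has to be
  given a basis. Orthogonality to \<open>e\<^sub>5\<close> makes \<open>e\<^sub>5\<close>
  central.\<close>

locale heisenberg_bracket =
  fixes br :: "real^'n \<Rightarrow> real^'n \<Rightarrow> real^'n" and g :: "real^'n \<Rightarrow> real^'n \<Rightarrow> real"
    and a :: real and e\<^sub>1 e\<^sub>2 e\<^sub>5 :: "real^'n"
  assumes g: "inner_product_on g" and lie: "lie_bracket br"
    and orthonormal: "g e\<^sub>1 e\<^sub>1 = 1" "g e\<^sub>2 e\<^sub>2 = 1" "g e\<^sub>5 e\<^sub>5 = 1"
      "g e\<^sub>1 e\<^sub>2 = 0" "g e\<^sub>1 e\<^sub>5 = 0" "g e\<^sub>2 e\<^sub>5 = 0"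
    and br: "br x y = (a * (g e\<^sub>1 x * g e\<^sub>2 y - g e\<^sub>2 x * g e\<^sub>1 y)) *\<^sub>R e\<^sub>5"
begin

lemma bil: "bilinear g"
  using g by (simp add: inner_product_on_def)

lemma sym: "g x y = g y x"
  using g by (simp add: inner_product_on_def)

lemma linear_g: "linear (g x)"
  using bil by (simp add: bilinear_def)

lemmas g_simps = bilinear_ladd[OF bil] bilinear_radd[OF bil] bilinear_lmul[OF bil]
  bilinear_rmul[OF bil] bilinear_lsub[OF bil] bilinear_rsub[OF bil]
  bilinear_lneg[OF bil] bilinear_rneg[OF bil] bilinear_lzero[OF bil] bilinear_rzero[OF bil]

lemmas orthonormal_simps = orthonormal orthonormal(4-6)[unfolded sym[of e\<^sub>1] sym[of e\<^sub>2 e\<^sub>5]]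

text \<open>Read off from the Koszul formula by collecting its right-hand side along
  \<open>g e\<^sub>1 w\<close>, \<open>g e\<^sub>2 w\<close> and
  \<open>g e\<^sub>5 w\<close>.\<close>

lemma levi_civita_eq:
  "levi_civita br g = (\<lambda>u v.
     (a / 2 * (g e\<^sub>2 v * g e\<^sub>5 u + g e\<^sub>2 u * g e\<^sub>5 v)) *\<^sub>R e\<^sub>1
     + (- a / 2 * (g e\<^sub>1 v * g e\<^sub>5 u + g e\<^sub>1 u * g e\<^sub>5 v)) *\<^sub>R e\<^sub>2
     + (a / 2 * (g e\<^sub>1 u * g e\<^sub>2 v - g e\<^sub>2 u * g e\<^sub>1 v)) *\<^sub>R e\<^sub>5)"
  by (rule levi_civita_eqI[OF g lie]) (simp add: br g_simps field_simps)

lemma ricci_eq: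
  "ricci br g u v = a\<^sup>2 / 2 * (g e\<^sub>5 u * g e\<^sub>5 v - g e\<^sub>1 u * g e\<^sub>1 v - g e\<^sub>2 u * g e\<^sub>2 v)"
proof -
  let ?N = "levi_civita br g"
  define R where "R e w = g e (riemann br g w u v)" for e w
  \<comment> \<open>The connection takes values in the span of the three orthonormal vectors, hence
    so does the curvature; as a map of \<open>w\<close> it is a sum of three rank-one maps.\<close>
  have riemann: "riemann br g w u v = R e\<^sub>1 w *\<^sub>R e\<^sub>1 + R e\<^sub>2 w *\<^sub>R e\<^sub>2 + R e\<^sub>5 w *\<^sub>R e\<^sub>5" for w
    by (simp add: R_def riemann_def Let_def levi_civita_eq g_simps orthonormal_simps br
        algebra_simps)
  have lin: "linear (R e)" for e
  proof -
    have N: "bilinear ?N" and B: "bilinear br"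
      using levi_civita_is_levi_civita[OF g lie] lie
      by (simp_all add: is_levi_civita_def lie_bracket_def)
    show ?thesis
      by (rule linearI)
         (simp_all add: R_def riemann_def Let_def g_simps bilinear_ladd[OF N] bilinear_radd[OF N]
          bilinear_lmul[OF N] bilinear_rmul[OF N] bilinear_ladd[OF B] bilinear_lmul[OF B]
          right_diff_distrib)
  qed
  have "ricci br g u v = R e\<^sub>1 e\<^sub>1 + R e\<^sub>2 e\<^sub>2 + R e\<^sub>5 e\<^sub>5"
    unfolding ricci_def riemann by (simp add: trace_matrix_add trace_matrix_scaleR lin)
  also have "\<dots> = a\<^sup>2 / 2 * (g e\<^sub>5 u * g e\<^sub>5 v - g e\<^sub>1 u * g e\<^sub>1 v - g e\<^sub>2 u * g e\<^sub>2 v)"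
    by (simp add: R_def riemann_def Let_def levi_civita_eq g_simps orthonormal_simps br
        field_simps power2_eq_square)
  finally show ?thesis .
qed

lemma schouten_like: "schouten_like br g"
proof -
  \<comment> \<open>The Ricci operator plus \<open>3 * a\<^sup>2 / 2\<close> times the identity: its
    eigenvalues are \<open>a\<^sup>2\<close> on \<open>e\<^sub>1\<close> and
    \<open>e\<^sub>2\<close>, \<open>2 * a\<^sup>2\<close> on \<open>e\<^sub>5\<close>, and
    \<open>3 * a\<^sup>2 / 2\<close> on the complement.\<close>
  define D where "D x = (3 * a\<^sup>2 / 2) *\<^sub>R x - (a\<^sup>2 / 2 * g e\<^sub>1 x) *\<^sub>R e\<^sub>1 - (a\<^sup>2 / 2 * g e\<^sub>2 x) *\<^sub>R e\<^sub>2
    + (a\<^sup>2 / 2 * g e\<^sub>5 x) *\<^sub>R e\<^sub>5" for x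
  have gD: "g (D x) y = 3 * a\<^sup>2 / 2 * g x y
      + a\<^sup>2 / 2 * (g e\<^sub>5 x * g e\<^sub>5 y - g e\<^sub>1 x * g e\<^sub>1 y - g e\<^sub>2 x * g e\<^sub>2 y)" for x y
    by (simp add: D_def g_simps algebra_simps)
  have "linear D"
    by (rule linearI) (simp_all add: D_def g_simps algebra_simps add_divide_distrib)
  moreover have "D (br x y) = br (D x) y + br x (D y)" for x y
  proof -
    \<comment> \<open>The bracket sees only the first two coordinates, each scaled by
      \<open>a\<^sup>2\<close>, so both sides equal \<open>2 * a\<^sup>2\<close> times the
      bracket.\<close>
    have "D e\<^sub>5 = (2 * a\<^sup>2) *\<^sub>R e\<^sub>5"
      by (simp add: D_def orthonormal_simps flip: scaleR_add_left)
    moreover have "g e\<^sub>1 (D x) = a\<^sup>2 * g e\<^sub>1 x" "g e\<^sub>2 (D x) = a\<^sup>2 * g e\<^sub>2 x" for x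
      by (simp_all add: D_def g_simps orthonormal_simps)
    ultimately show ?thesis
      unfolding br linear_cmul[OF \<open>linear D\<close>] by (simp add: algebra_simps flip: scaleR_add_left)
  qed
  ultimately have "derivation br D"
    by (simp add: derivation_def)
  moreover have "symmetric_wrt g D"
  proof -
    have "g (D x) y = g (D y) x" for x y
      by (simp add: gD sym[of x y] mult.commute)
    then show ?thesis
      unfolding symmetric_wrt_def using sym by metis
  qed
  moreover have "ricci br g x y = (scalar_curvature br g * 0 + - 3 * a\<^sup>2 / 2) * g x y + g (D x) y"
    for x y
    by (simp add: ricci_eq gD)
  ultimately show ?thesis
    unfolding schouten_like_def by blast
qed

end

lemma inner_product_normalize:
  assumes "inner_product_on g" "x \<noteq> 0"
  obtains r e where "r > 0" "x = r *\<^sub>R e" "g e e = 1"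
proof
  have pos: "g x x > 0" and bil: "bilinear g"
    using assms by (simp_all add: inner_product_on_def)
  let ?r = "sqrt (g x x)"
  show "?r > 0" "x = ?r *\<^sub>R ((1 / ?r) *\<^sub>R x)"
    using pos by simp_all
  show "g ((1 / ?r) *\<^sub>R x) ((1 / ?r) *\<^sub>R x) = 1"
    using pos by (simp add: bilinear_lmul[OF bil] bilinear_rmul[OF bil] flip: real_sqrt_mult)
qed

text \<open>\<open>f\<close> and \<open>h\<close> are the coordinate functionals dual to
  \<open>v 1\<close> and \<open>v 2\<close>, and \<open>z\<close> is \<open>v 5\<close>; both sides
  are bilinear and agree on pairs of basis vectors. The vectors \<open>p\<close> and
  \<open>q\<close> witness that \<open>f\<close> and \<open>h\<close> are linearly
  independent.\<close>

lemma A31_2A1_bracket_form: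
  assumes "A31_2A1 br"
  obtains f h :: "real^5 \<Rightarrow> real" and p q z :: "real^5" and \<alpha> where
    "linear f" "linear h" "f p = 1" "f q = 0" "h p = 0" "h q = 1" "f z = 0" "h z = 0" "z \<noteq> 0"
    "\<And>x y. br x y = (\<alpha> * (f x * h y - h x * f y)) *\<^sub>R z"
proof -
  obtain v :: "nat \<Rightarrow> real^5" and \<alpha> where lie: "lie_bracket br"
    and inj: "inj_on v {1..5}" and ind: "independent (v ` {1..5})"
    and span: "span (v ` {1..5}) = UNIV"
    and br12: "br (v 1) (v 2) = \<alpha> *\<^sub>R v 5"
    and br0: "\<And>i j. i \<in> {1..5} \<Longrightarrow> j \<in> {1..5} \<Longrightarrow> i < j \<Longrightarrow> (i, j) \<noteq> (1, 2) \<Longrightarrow> br (v i) (v j) = 0"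
    using assms unfolding A31_2A1_def by metis
  have bb: "bilinear br" and alt: "br x x = 0" for x
    using lie by (simp_all add: lie_bracket_def)
  have anti: "br x y = - br y x" for x y
    using alt[of "x + y"] alt[of x] alt[of y]
    by (simp add: bilinear_ladd[OF bb] bilinear_radd[OF bb] eq_neg_iff_add_eq_0 add.commute)
  have "\<exists>f. linear f \<and> (\<forall>j\<in>{1..5}. f (v j) = (if j = i then 1 else 0 :: real))" for i
  proof -
    \<comment> \<open>The extension theorem prescribes values on vectors, so the index is recovered
      from the vector by inverting \<open>v\<close>.\<close>
    obtain f where "linear f"
      "\<forall>x\<in>v ` {1..5}. f x = (if the_inv_into {1..5} v x = i then 1 else 0 :: real)"
      using linear_independent_extend[OF ind,
          of "\<lambda>x. if the_inv_into {1..5} v x = i then 1 else 0"] by (elim exE conjE)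
    moreover have "the_inv_into {1..5} v (v j) = j" if "j \<in> {1..5}" for j
      using the_inv_into_f_f[OF inj that] .
    ultimately have "f (v j) = (if j = i then 1 else 0)" if "j \<in> {1..5}" for j
      by (metis that imageI)
    then show ?thesis
      using \<open>linear f\<close> by blast
  qed
  then obtain f where f: "linear (f i)"
    "j \<in> {1..5} \<Longrightarrow> f i (v j) = (if j = i then 1 else 0 :: real)" for i j
    by metis
  define B where "B x y = (\<alpha> * (f 1 x * f 2 y - f 2 x * f 1 y)) *\<^sub>R v 5" for x y
  have "bilinear B"
    unfolding bilinear_def B_def
    by (auto intro!: linearI simp: linear_add[OF f(1)] linear_cmul[OF f(1)] algebra_simps)
  have less_basis: "br (v i) (v j) = B (v i) (v j)" if "i \<in> {1..5}" "j \<in> {1..5}" "i < j" for i j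
    using that by (cases "(i, j) = (1, 2)") (auto simp: B_def f br12[simplified] br0)
  have B_anti: "B x y = - B y x" for x y
    by (simp add: B_def algebra_simps)
  have basis: "br (v i) (v j) = B (v i) (v j)" if "i \<in> {1..5}" "j \<in> {1..5}" for i j
  proof (cases i j rule: linorder_cases)
    case less
    then show ?thesis
      by (rule less_basis[OF that])
  next
    case equal
    then show ?thesis
      by (simp add: alt B_def)
  next
    case greater
    then show ?thesis
      using less_basis[OF that(2,1)] anti B_anti by metis
  qed
  have "br x y = B x y" for x y
    by (rule bilinear_eq[OF bb \<open>bilinear B\<close>, of UNIV "v ` {1..5}" UNIV "v ` {1..5}"])
       (auto simp only: span basis)
  moreover have "v 5 \<noteq> 0"
    using ind dependent_zero[of "v ` {1..5}"] by (metis atLeastAtMost_iff image_eqI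
        numeral_le_iff one_le_numeral order_refl)
  ultimately show ?thesis
    using that[of "f 1" "f 2" "v 1" "v 2" "v 5" \<alpha>] f unfolding B_def by simp
qed

theorem proposition5:
  fixes br :: "real^5 \<Rightarrow> real^5 \<Rightarrow> real^5" and g :: "real^5 \<Rightarrow> real^5 \<Rightarrow> real"
  assumes "A31_2A1 br" and "inner_product_on g"
  shows "schouten_like br g"
proof -
  note g = assms(2)
  have bil: "bilinear g" and sym: "g x y = g y x" for x y
    using g by (simp_all add: inner_product_on_def)
  note g_simps = bilinear_lmul[OF bil] bilinear_rmul[OF bil] bilinear_lsub[OF bil]
    bilinear_lzero[OF bil]
  obtain f h :: "real^5 \<Rightarrow> real" and p q z :: "real^5" and \<alpha> where lin: "linear f" "linear h"
    and dual: "f p = 1" "f q = 0" "h p = 0" "h q = 1" "f z = 0" "h z = 0" and "z \<noteq> 0"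
    and br: "\<And>x y. br x y = (\<alpha> * (f x * h y - h x * f y)) *\<^sub>R z"
    by (rule A31_2A1_bracket_form[OF assms(1)]) (rule that)
  obtain m n where m: "g m x = f x" and n: "g n x = h x" for x
    using inner_product_riesz[OF g lin(1)] inner_product_riesz[OF g lin(2)] by metis
  have "m \<noteq> 0"
    using m[of p] dual by (auto simp: g_simps)
  then obtain r e\<^sub>1 where r: "r > 0" "m = r *\<^sub>R e\<^sub>1" "g e\<^sub>1 e\<^sub>1 = 1"
    using inner_product_normalize[OF g] by metis
  \<comment> \<open>If the Gram-Schmidt remainder vanished, \<open>h\<close> would be a multiple of
    \<open>f\<close>, contradicting their values at \<open>q\<close>.\<close>
  have "n - g n e\<^sub>1 *\<^sub>R e\<^sub>1 \<noteq> 0"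
  proof
    assume "n - g n e\<^sub>1 *\<^sub>R e\<^sub>1 = 0"
    then have "h x = g n e\<^sub>1 * g e\<^sub>1 x" for x
      using n[of x] by (metis bilinear_lmul[OF bil] eq_iff_diff_eq_0 real_scaleR_def)
    moreover have "g e\<^sub>1 q = 0"
      using m[of q] r dual by (simp add: g_simps)
    ultimately show False
      using dual by simp
  qed
  then obtain s e\<^sub>2 where s: "s > 0" "n - g n e\<^sub>1 *\<^sub>R e\<^sub>1 = s *\<^sub>R e\<^sub>2" "g e\<^sub>2 e\<^sub>2 = 1"
    using inner_product_normalize[OF g] by metis
  obtain t e\<^sub>5 where t: "t > 0" "z = t *\<^sub>R e\<^sub>5" "g e\<^sub>5 e\<^sub>5 = 1"
    using inner_product_normalize[OF g \<open>z \<noteq> 0\<close>] by metis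
  have f: "f x = r * g e\<^sub>1 x" for x
    using m[of x] r by (simp add: g_simps)
  have h: "h x = g n e\<^sub>1 * g e\<^sub>1 x + s * g e\<^sub>2 x" for x
    using n[of x] arg_cong[OF s(2), of "\<lambda>w. g w x"] by (simp add: g_simps)
  \<comment> \<open>Since \<open>f\<close> and \<open>h\<close> both vanish at \<open>z\<close>, the
    direction of \<open>z\<close> is orthogonal to both representatives.\<close>
  have "g e\<^sub>1 e\<^sub>5 = 0"
    using f[of z] r t dual by (simp add: g_simps)
  moreover have "g e\<^sub>2 e\<^sub>5 = 0"
    using h[of z] s t dual \<open>g e\<^sub>1 e\<^sub>5 = 0\<close> by (simp add: g_simps)
  \<comment> \<open>Comparing the two expressions for \<open>h e\<^sub>1\<close> leaves
    \<open>s * g e\<^sub>2 e\<^sub>1 = 0\<close>.\<close>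
  moreover have "g e\<^sub>1 e\<^sub>2 = 0"
    using h[of e\<^sub>1] n[of e\<^sub>1] s r sym[of e\<^sub>1 e\<^sub>2] by simp
  \<comment> \<open>The part of \<open>h\<close> proportional to \<open>f\<close> cancels by
    antisymmetry, and the normalizing factors collect into the structure constant.\<close>
  moreover have "br x y = (\<alpha> * r * s * t * (g e\<^sub>1 x * g e\<^sub>2 y - g e\<^sub>2 x * g e\<^sub>1 y)) *\<^sub>R e\<^sub>5" for x y
    unfolding br f h t(2) by (simp add: algebra_simps)
  ultimately interpret heisenberg_bracket br g "\<alpha> * r * s * t" e\<^sub>1 e\<^sub>2 e\<^sub>5
    using assms r s t by unfold_locales (simp_all add: A31_2A1_def)
  show ?thesis
    by (rule schouten_like)
qed

end
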